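(* Every lifted-graphic matroid is quasi-graphic.
   Context: For a graph $G$ and a vertex $v$, $\mathrm{loops}_G(v)$ denotes the set of loop-edges of $G$ at $v$. Graphs are finite and may have loops and parallel edges. For a set $X$ of edges, $G[X]$ is the subgraph of $G$ with edge-set $X$ and no isolated vertices. A graph $G$ is a framework for a matroid $M$ if (1) $E(G)=E(M)$; (2) $r_M(E(H))\le |V(H)|$ for each component $H$ of $G$; (3) for each vertex $v$ of $G$, $\mathrm{cl}_M(E(G-v))\subseteq E(G-v)\cup \mathrm{loops}_G(v)$; and (4) for each circuit $C$ of $M$, the subgraph $G[C]$ has at most two components. A matroid is quasi-graphic if it has a framework. A matroid $M$ is lifted-graphic if there is a matroid $M'$ and an element $e\in E(M')$ such that $M'\setminus e=M$ and $M'/e$ is graphic. *)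

theory Defs
  imports Main
begin

section \<open>Finite graphs with loops and parallel edges\<close>

text \<open>\<open>ends G e\<close> is the set of end-vertices of the edge \<open>e\<close>; it has one element precisely
  when \<open>e\<close> is a loop.\<close>

record ('v, 'e) pre_multigraph =
  verts :: "'v set"
  edges :: "'e set"
  ends :: "'e \<Rightarrow> 'v set"

locale multigraph =
  fixes G :: "('v, 'e) pre_multigraph"
  assumes finite_verts: "finite (verts G)"
    and finite_edges: "finite (edges G)"
    and ends_subset: "e \<in> edges G \<Longrightarrow> ends G e \<subseteq> verts G"
    and card_ends: "e \<in> edges G \<Longrightarrow> card (ends G e) = 1 \<or> card (ends G e) = 2"

definition loops :: "('v, 'e) pre_multigraph \<Rightarrow> 'v \<Rightarrow> 'e set" where
  "loops G v = {e \<in> edges G. ends G e = {v}}"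

definition induced_subgraph :: "('v, 'e) pre_multigraph \<Rightarrow> 'v set \<Rightarrow> ('v, 'e) pre_multigraph" where
  "induced_subgraph G U =
    \<lparr>verts = U \<inter> verts G, edges = {e \<in> edges G. ends G e \<subseteq> U}, ends = ends G\<rparr>"

definition delete_vertex :: "('v, 'e) pre_multigraph \<Rightarrow> 'v \<Rightarrow> ('v, 'e) pre_multigraph" where
  "delete_vertex G v = induced_subgraph G (verts G - {v})"

text \<open>The subgraph $G[X]$ with edge-set $X$ and no isolated vertices.\<close>

definition edge_subgraph :: "('v, 'e) pre_multigraph \<Rightarrow> 'e set \<Rightarrow> ('v, 'e) pre_multigraph" where
  "edge_subgraph G X = \<lparr>verts = (\<Union>e \<in> X. ends G e), edges = X, ends = ends G\<rparr>"

definition adjacent :: "('v, 'e) pre_multigraph \<Rightarrow> 'v \<Rightarrow> 'v \<Rightarrow> bool" where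
  "adjacent G u v \<longleftrightarrow> (\<exists>e \<in> edges G. ends G e = {u, v})"

definition component_of :: "('v, 'e) pre_multigraph \<Rightarrow> 'v \<Rightarrow> ('v, 'e) pre_multigraph" where
  "component_of G v = induced_subgraph G {u \<in> verts G. rtranclp (adjacent G) v u}"

definition components :: "('v, 'e) pre_multigraph \<Rightarrow> ('v, 'e) pre_multigraph set" where
  "components G = component_of G ` verts G"

text \<open>\<open>C\<close> is the edge-set of a cycle with distinct vertices \<open>vs\<close> and distinct edges \<open>es\<close>
  in cyclic order. A cycle of length one is a loop; one of length two is a pair of parallel edges.\<close>

definition is_cycle :: "('v, 'e) pre_multigraph \<Rightarrow> 'e set \<Rightarrow> bool" where
  "is_cycle G C \<longleftrightarrow>
    (\<exists>vs es. es \<noteq> [] \<and> length vs = length es \<and> distinct vs \<and> distinct es \<and>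
      set vs \<subseteq> verts G \<and> set es \<subseteq> edges G \<and>
      (\<forall>i < length es. ends G (es ! i) = {vs ! i, vs ! (Suc i mod length es)}) \<and>
      C = set es)"


section \<open>Finite matroids\<close>

record 'a pre_matroid =
  ground :: "'a set"
  indeps :: "'a set set"

locale matroid =
  fixes M :: "'a pre_matroid"
  assumes finite_ground: "finite (ground M)"
    and indep_subset_ground: "I \<in> indeps M \<Longrightarrow> I \<subseteq> ground M"
    and empty_indep: "{} \<in> indeps M"
    and indep_subset: "I \<in> indeps M \<Longrightarrow> J \<subseteq> I \<Longrightarrow> J \<in> indeps M"
    and augment: "I \<in> indeps M \<Longrightarrow> J \<in> indeps M \<Longrightarrow> card I < card J \<Longrightarrow>
      \<exists>x \<in> J - I. insert x I \<in> indeps M"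

definition rank :: "'a pre_matroid \<Rightarrow> 'a set \<Rightarrow> nat" where
  "rank M X = Max (card ` {I \<in> indeps M. I \<subseteq> X})"

definition cl :: "'a pre_matroid \<Rightarrow> 'a set \<Rightarrow> 'a set" where
  "cl M X = {x \<in> ground M. rank M (insert x X) = rank M X}"

definition circuit :: "'a pre_matroid \<Rightarrow> 'a set \<Rightarrow> bool" where
  "circuit M C \<longleftrightarrow> C \<subseteq> ground M \<and> C \<notin> indeps M \<and> (\<forall>D. D \<subset> C \<longrightarrow> D \<in> indeps M)"

definition basis_of :: "'a pre_matroid \<Rightarrow> 'a set \<Rightarrow> 'a set \<Rightarrow> bool" where
  "basis_of M X B \<longleftrightarrow> B \<in> indeps M \<and> B \<subseteq> X \<and>
    (\<forall>I \<in> indeps M. B \<subseteq> I \<and> I \<subseteq> X \<longrightarrow> I = B)"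

definition delete :: "'a pre_matroid \<Rightarrow> 'a set \<Rightarrow> 'a pre_matroid" where
  "delete M X = \<lparr>ground = ground M - X, indeps = {I \<in> indeps M. I \<subseteq> ground M - X}\<rparr>"

definition contract :: "'a pre_matroid \<Rightarrow> 'a set \<Rightarrow> 'a pre_matroid" where
  "contract M X = \<lparr>ground = ground M - X,
    indeps = {I. I \<subseteq> ground M - X \<and> (\<exists>B. basis_of M X B \<and> I \<union> B \<in> indeps M)}\<rparr>"

text \<open>Relabelling of the elements; only used with injective \<open>f\<close>.\<close>

definition map_matroid :: "('a \<Rightarrow> 'b) \<Rightarrow> 'a pre_matroid \<Rightarrow> 'b pre_matroid" where
  "map_matroid f M = \<lparr>ground = f ` ground M, indeps = (\<lambda>I. f ` I) ` indeps M\<rparr>"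

definition cycle_matroid :: "('v, 'e) pre_multigraph \<Rightarrow> 'e pre_matroid" where
  "cycle_matroid G = \<lparr>ground = edges G,
    indeps = {I. I \<subseteq> edges G \<and> \<not> (\<exists>C. C \<subseteq> I \<and> is_cycle G C)}\<rparr>"


section \<open>Graphic, lifted-graphic and quasi-graphic matroids\<close>

text \<open>HOL cannot quantify existentially over the type of vertices. Since graphs are finite,
  taking natural numbers as vertices loses nothing.\<close>

definition graphic :: "'a pre_matroid \<Rightarrow> bool" where
  "graphic M \<longleftrightarrow> (\<exists>G :: (nat, 'a) pre_multigraph. multigraph G \<and> M = cycle_matroid G)"

definition framework :: "('v, 'a) pre_multigraph \<Rightarrow> 'a pre_matroid \<Rightarrow> bool" where
  "framework G M \<longleftrightarrow> multigraph G \<and>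
    edges G = ground M \<and>
    (\<forall>H \<in> components G. rank M (edges H) \<le> card (verts H)) \<and>
    (\<forall>v \<in> verts G. cl M (edges (delete_vertex G v)) \<subseteq> edges (delete_vertex G v) \<union> loops G v) \<and>
    (\<forall>C. circuit M C \<longrightarrow> card (components (edge_subgraph G C)) \<le> 2)"

definition quasi_graphic :: "'a pre_matroid \<Rightarrow> bool" where
  "quasi_graphic M \<longleftrightarrow> (\<exists>G :: (nat, 'a) pre_multigraph. framework G M)"

text \<open>The matroid \<open>M'\<close> has one element more than \<open>M\<close>, and the type \<open>'a\<close> might have no element
  outside \<open>ground M\<close>. Therefore \<open>M'\<close> lives on \<open>'a option\<close>, and \<open>M\<close> is identified with its copy
  under \<open>Some\<close>.\<close>

definition lifted_graphic :: "'a pre_matroid \<Rightarrow> bool" where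
  "lifted_graphic M \<longleftrightarrow>
    (\<exists>(M' :: 'a option pre_matroid) e. matroid M' \<and> e \<in> ground M' \<and>
      delete M' {e} = map_matroid Some M \<and> graphic (contract M' {e}))"

end

(* Let G be a graph whose cycle matroid is N = M'/e, where M = M' \ e. Then G itself is a framework
   for M. Contracting e lowers ranks by at most one, which gives (2), and it preserves spanning,
   which gives (3) because a cycle never has exactly one edge at a vertex. For (4), let C be a circuit
   of M. As C - f spans f in M, hence in N, every edge f of C lies in a cycle of G inside C. With three
   components there would be disjoint cycles D1, D2, D3 inside C. Then D1 \<union> D2 is independent
   in M', but both D1 and D2 span e, so e is a loop of M', and D1 is dependent in M: a contradiction. *)

theory Submission
  imports Defs
begin

section \<open>Matroids and the contraction of an element\<close>

context matroid
begin

section \<open>Augmentation and bases\<close>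

lemma indep_finite: "I \<in> indeps M \<Longrightarrow> finite I"
  using finite_ground indep_subset_ground finite_subset by blast

lemma finite_indeps: "finite (indeps M)"
  using finite_ground indep_subset_ground by (auto intro: finite_subset[of _ "Pow (ground M)"])

text \<open>Iterated augmentation. The added set \<open>K\<close> stays explicit because later
  arguments depend on which elements of \<open>J\<close> it takes in or misses.\<close>

lemma augment_to_card:
  assumes "I \<in> indeps M" "J \<in> indeps M" "card I \<le> card J"
  shows "\<exists>K \<subseteq> J - I. I \<union> K \<in> indeps M \<and> card (I \<union> K) = card J"
  using assms
proof (induction "card J - card I" arbitrary: I)
  case 0
  then show ?case by (intro exI[of _ "{}"]) auto
next
  case (Suc n)
  then have "card I < card J" by simp
  then obtain x where x: "x \<in> J - I" "insert x I \<in> indeps M"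
    using augment Suc.prems by blast
  have c: "card (insert x I) = Suc (card I)"
    using x indep_finite[OF Suc.prems(1)] by auto
  have "n = card J - card (insert x I)" using Suc.hyps(2) c by simp
  moreover have "card (insert x I) \<le> card J" using c \<open>card I < card J\<close> by simp
  ultimately obtain K where K: "K \<subseteq> J - insert x I" "insert x I \<union> K \<in> indeps M"
    "card (insert x I \<union> K) = card J"
    using Suc.hyps(1)[of "insert x I"] x Suc.prems by blast
  show ?case using K x by (intro exI[of _ "insert x K"]) auto
qed

lemma indep_extends_to_basis_of:
  assumes "I \<in> indeps M" "I \<subseteq> X"
  shows "\<exists>B. basis_of M X B \<and> I \<subseteq> B"
proof -
  let ?S = "{J \<in> indeps M. J \<subseteq> X}"
  have "finite ?S" using finite_indeps by simp
  moreover have "I \<in> ?S" using assms by simp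
  ultimately obtain B where "B \<in> ?S" "I \<subseteq> B" "\<forall>J \<in> ?S. B \<subseteq> J \<longrightarrow> J = B"
    using finite_has_maximal2[of ?S I] by (metis (lifting))
  then show ?thesis unfolding basis_of_def by auto
qed

lemma card_indep_le_basis_of:
  assumes "basis_of M X B" "I \<in> indeps M" "I \<subseteq> X"
  shows "card I \<le> card B"
proof (rule ccontr)
  assume "\<not> card I \<le> card B"
  then obtain x where "x \<in> I - B" "insert x B \<in> indeps M"
    using augment[of B I] assms unfolding basis_of_def by auto
  then show False using assms unfolding basis_of_def by blast
qed

text \<open>If \<open>insert f B\<close> were independent, \<open>I\<close> could be enlarged from
  it to more than \<open>card B\<close> elements. As \<open>f\<close> cannot be among the added
  ones, the enlarged set would lie in \<open>X\<close>, too large for the basis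
  \<open>B\<close>.\<close>

lemma basis_of_spans:
  assumes B: "basis_of M X B" and f: "f \<notin> B"
    and I: "I \<in> indeps M" "I \<subseteq> X" "insert f I \<notin> indeps M"
  shows "insert f B \<notin> indeps M"
proof
  assume ind: "insert f B \<in> indeps M"
  have "finite B" using indep_finite[OF ind] by simp
  then have c: "card (insert f B) = Suc (card B)" using f by simp
  then have "card I \<le> card (insert f B)" using card_indep_le_basis_of[OF B I(1,2)] by simp
  then obtain K where K: "K \<subseteq> insert f B - I" "I \<union> K \<in> indeps M" "card (I \<union> K) = Suc (card B)"
    using augment_to_card[OF I(1) ind] c by auto
  have "f \<notin> K" using K(2) I(3) indep_subset[of "I \<union> K" "insert f I"] by auto
  then have "I \<union> K \<subseteq> X" using K(1) I(2) B unfolding basis_of_def by auto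
  then have "card (I \<union> K) \<le> card B" using card_indep_le_basis_of[OF B K(2)] by simp
  then show False using K(3) by simp
qed

section \<open>Contraction of a single element\<close>

lemma indep_contract_nonloop:
  assumes "{e} \<in> indeps M"
  shows "I \<in> indeps (contract M {e}) \<longleftrightarrow> e \<notin> I \<and> insert e I \<in> indeps M"
proof -
  have "basis_of M {e} B \<longleftrightarrow> B = {e}" for B
    using assms unfolding basis_of_def by blast
  then show ?thesis
    using indep_subset_ground[of "insert e I"] unfolding contract_def by auto
qed

lemma indep_contract_loop:
  assumes "{e} \<notin> indeps M"
  shows "I \<in> indeps (contract M {e}) \<longleftrightarrow> I \<in> indeps M"
proof -
  have "basis_of M {e} B \<longleftrightarrow> B = {}" for B
    using assms empty_indep unfolding basis_of_def by (auto simp: subset_singleton_iff)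
  moreover have "e \<notin> I" if "I \<in> indeps M"
    using that assms indep_subset[of I "{e}"] by auto
  ultimately show ?thesis
    using indep_subset_ground[of I] unfolding contract_def by auto
qed

text \<open>If \<open>e\<close> is not a loop, a basis of \<open>insert e X\<close> containing
  \<open>e\<close> spans \<open>f\<close>, and still does so in the contraction once
  \<open>e\<close> is removed from it. If \<open>e\<close> is a loop, contraction leaves the
  independent sets unchanged. Spanning is phrased by independent sets because this form later yields
  a cycle through \<open>f\<close>.\<close>

lemma contract_spans:
  assumes I: "I \<in> indeps M" "I \<subseteq> X" "insert f I \<notin> indeps M"
    and f: "f \<notin> X" "f \<noteq> e" and e: "e \<notin> X"
  shows "\<exists>J \<subseteq> X. J \<in> indeps (contract M {e}) \<and> insert f J \<notin> indeps (contract M {e})"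
proof (cases "{e} \<in> indeps M")
  case True
  obtain B where B: "basis_of M (insert e X) B" "{e} \<subseteq> B"
    using indep_extends_to_basis_of[OF True, of "insert e X"] by auto
  have "f \<notin> B" using B f unfolding basis_of_def by auto
  then have "insert f B \<notin> indeps M"
    using basis_of_spans[OF B(1), of f I] I by auto
  moreover have "insert e (B - {e}) = B" "insert e (insert f (B - {e})) = insert f B"
    using B by auto
  ultimately show ?thesis
    using B f e unfolding indep_contract_nonloop[OF True] basis_of_def
    by (intro exI[of _ "B - {e}"]) auto
next
  case False
  then show ?thesis using I indep_contract_loop by blast
qed

text \<open>If \<open>e\<close> is not a loop, augmenting \<open>{e}\<close> from \<open>I\<close>
  to the size of \<open>I\<close> takes in all but at most one element of \<open>I\<close>.\<close>

lemma contract_rank_drop: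
  assumes "I \<in> indeps M"
  shows "\<exists>J \<subseteq> I. J \<in> indeps (contract M {e}) \<and> card I \<le> Suc (card J)"
\<comment> \<open>An empty \<open>I\<close> belongs to the other case, since \<open>{e}\<close> is
  already larger than it.\<close>
proof (cases "{e} \<in> indeps M \<and> I \<noteq> {}")
  case True
  then have "card I \<ge> 1" using indep_finite[OF assms] by (simp add: Suc_le_eq card_gt_0_iff)
  then obtain K where K: "K \<subseteq> I - {e}" "{e} \<union> K \<in> indeps M" "card ({e} \<union> K) = card I"
    using augment_to_card[of "{e}" I] True assms by auto
  have "card ({e} \<union> K) \<le> Suc (card K)" by (simp add: card_insert_le_m1)
  then show ?thesis using K True by (auto simp: indep_contract_nonloop)
next
  case False
  then have "I \<in> indeps (contract M {e})"
    using assms indep_contract_nonloop indep_contract_loop by auto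
  then show ?thesis by (intro exI[of _ I]) simp
qed

text \<open>If both sets were dependent in the contraction, both would span \<open>e\<close> in \<open>M\<close>. An independent set
  containing \<open>e\<close> would then miss an element of each, but \<open>{e}\<close> can be augmented from
  \<open>D1 \<union> D2\<close> to a set missing only one.\<close>

lemma contract_disjoint_dependent:
  assumes ind: "D1 \<union> D2 \<in> indeps M" and disj: "D1 \<inter> D2 = {}"
    and e: "e \<notin> D1 \<union> D2" and D1: "D1 \<notin> indeps (contract M {e})"
  shows "D2 \<in> indeps (contract M {e})"
proof (rule ccontr)
  assume D2: "D2 \<notin> indeps (contract M {e})"
  \<comment> \<open>If \<open>e\<close> were a loop, \<open>D1\<close> would stay independent in the
    contraction.\<close>
  have ne: "{e} \<in> indeps M"
    using D1 indep_contract_loop indep_subset[OF ind, of D1] by auto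
  have dep: "insert e D1 \<notin> indeps M" "insert e D2 \<notin> indeps M"
    using D1 D2 e unfolding indep_contract_nonloop[OF ne] by auto
  have fin: "finite D1" "finite D2" using indep_finite[OF ind] by auto
  have "D1 \<noteq> {}" using dep(1) ne by auto
  then have "card {e} \<le> card (D1 \<union> D2)" using fin by (simp add: Suc_le_eq card_gt_0_iff)
  then obtain K where K: "K \<subseteq> D1 \<union> D2" "insert e K \<in> indeps M"
    "card (insert e K) = card (D1 \<union> D2)"
    using augment_to_card[OF ne ind] by auto
  have "\<not> D1 \<subseteq> K" "\<not> D2 \<subseteq> K"
    using dep indep_subset[OF K(2)] by (meson insert_mono)+
  then obtain a b where ab: "a \<in> D1" "b \<in> D2" "a \<notin> K" "b \<notin> K" by auto
  have "finite K" using fin K(1) finite_subset by blast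
  then have "card K + 2 = card (insert a (insert b K))"
    using ab disj by (auto simp: card_insert_if)
  moreover have "card (insert a (insert b K)) \<le> card (D1 \<union> D2)"
    using ab K(1) fin by (intro card_mono) auto
  moreover have "card (insert e K) \<le> Suc (card K)"
    by (simp add: \<open>finite K\<close> card_insert_if)
  ultimately show False using K(3) by simp
qed

section \<open>Rank and closure in terms of independent sets\<close>

lemma rank_le_iff: "rank M X \<le> n \<longleftrightarrow> (\<forall>I \<in> indeps M. I \<subseteq> X \<longrightarrow> card I \<le> n)"
  unfolding rank_def using finite_indeps empty_indep by (subst Max_le_iff) auto

lemma card_le_rank: "I \<in> indeps M \<Longrightarrow> I \<subseteq> X \<Longrightarrow> card I \<le> rank M X"
  using rank_le_iff[of X "rank M X"] by simp

lemma rank_attained: "\<exists>I \<in> indeps M. I \<subseteq> X \<and> card I = rank M X"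
proof -
  have "rank M X \<in> card ` {I \<in> indeps M. I \<subseteq> X}"
    unfolding rank_def using finite_indeps empty_indep by (intro Max_in) auto
  then show ?thesis by auto
qed

text \<open>An independent subset of \<open>X\<close> of full rank serves as \<open>I\<close>: it
  misses \<open>f\<close>, so independence of \<open>insert f I\<close> would raise the
  rank.\<close>

lemma in_cl_dependent:
  assumes "f \<in> cl M X" "f \<notin> X"
  shows "\<exists>I \<in> indeps M. I \<subseteq> X \<and> insert f I \<notin> indeps M"
proof -
  obtain I where I: "I \<in> indeps M" "I \<subseteq> X" "card I = rank M X" using rank_attained by blast
  have "card (insert f I) = Suc (card I)"
    using I assms indep_finite[OF I(1)] by (auto simp: card_insert_if)
  then have "insert f I \<notin> indeps M"
    using card_le_rank[of "insert f I" "insert f X"] I assms unfolding cl_def by auto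
  then show ?thesis using I by blast
qed

end


section \<open>Cycles and forests\<close>

lemma indep_cycle_matroid_subset:
  "I \<in> indeps (cycle_matroid G) \<Longrightarrow> J \<subseteq> I \<Longrightarrow> J \<in> indeps (cycle_matroid G)"
  unfolding cycle_matroid_def using subset_trans[of _ J I] by auto

lemma cycle_dependent: "is_cycle G C \<Longrightarrow> C \<notin> indeps (cycle_matroid G)"
  unfolding cycle_matroid_def by auto

lemma cycle_through_edge:
  assumes "J \<in> indeps (cycle_matroid G)" "insert f J \<notin> indeps (cycle_matroid G)" "f \<in> edges G"
  shows "\<exists>C. is_cycle G C \<and> C \<subseteq> insert f J \<and> f \<in> C"
proof -
  obtain C where C: "is_cycle G C" "C \<subseteq> insert f J"
    using assms unfolding cycle_matroid_def by auto
  moreover have "\<not> C \<subseteq> J" using C(1) assms(1) unfolding cycle_matroid_def by auto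
  ultimately show ?thesis by blast
qed

text \<open>The graph that represents the contraction has edges of type \<open>'a option\<close>;
  this carries its cycles over to a graph on the ground set of \<open>M\<close>. End-vertices are
  compared on edges only, as \<open>ends\<close> is arbitrary elsewhere.\<close>

lemma is_cycle_relabel:
  assumes inj: "inj f" and V: "verts H = verts G" and E: "edges H = f ` edges G"
    and ends: "\<And>e. e \<in> edges G \<Longrightarrow> ends H (f e) = ends G e"
  shows "is_cycle H (f ` C) \<longleftrightarrow> is_cycle G C"
proof
  assume "is_cycle G C"
  then obtain vs es where c: "es \<noteq> []" "length vs = length es" "distinct vs" "distinct es"
      "set vs \<subseteq> verts G" "set es \<subseteq> edges G"
      "\<forall>i < length es. ends G (es ! i) = {vs ! i, vs ! (Suc i mod length es)}" "C = set es"
    unfolding is_cycle_def by auto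
  have "ends H (map f es ! i) = {vs ! i, vs ! (Suc i mod length es)}" if "i < length es" for i
    using c(6,7) ends[of "es ! i"] that by (auto simp: subset_iff)
  moreover have "distinct (map f es)"
    using c(4) inj by (simp add: distinct_map inj_on_def)
  ultimately show "is_cycle H (f ` C)"
    unfolding is_cycle_def using c V E
    by (intro exI[of _ vs] exI[of _ "map f es"]) auto
next
  assume "is_cycle H (f ` C)"
  then obtain vs es' where c: "es' \<noteq> []" "length vs = length es'" "distinct vs" "distinct es'"
      "set vs \<subseteq> verts H" "set es' \<subseteq> edges H"
      "\<forall>i < length es'. ends H (es' ! i) = {vs ! i, vs ! (Suc i mod length es')}" "f ` C = set es'"
    unfolding is_cycle_def by auto
  \<comment> \<open>Every edge of \<open>H\<close> is an image under \<open>f\<close>, so mapping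
    \<open>es\<close> forward again recovers \<open>es'\<close>.\<close>
  define es where "es = map (inv f) es'"
  have es': "es' = map f es"
    unfolding es_def using c(6) E inj by (auto simp: f_inv_into_f intro!: map_idI[symmetric])
  have C: "C = set es" using c(8) inj unfolding es' by (auto simp: inj_image_eq_iff)
  have sub: "set es \<subseteq> edges G" using c(6) E inj unfolding es' by (auto simp: inj_image_subset_iff)
  have "ends G (es ! i) = {vs ! i, vs ! (Suc i mod length es)}" if "i < length es" for i
    using c(7) ends[of "es ! i"] that sub unfolding es' by (auto simp: subset_iff)
  then show "is_cycle G C"
    unfolding is_cycle_def using c V C sub unfolding es'
    by (intro exI[of _ vs] exI[of _ es]) (auto simp: distinct_map)
qed

lemma cycle_matroid_relabel:
  assumes inj: "inj f" and V: "verts H = verts G" and E: "edges H = f ` edges G"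
    and ends: "\<And>e. e \<in> edges G \<Longrightarrow> ends H (f e) = ends G e"
  shows "cycle_matroid H = map_matroid f (cycle_matroid G)"
proof -
  note cyc = is_cycle_relabel[OF assms]
  have acyc: "(\<exists>C. C \<subseteq> f ` I \<and> is_cycle H C) \<longleftrightarrow> (\<exists>C. C \<subseteq> I \<and> is_cycle G C)" for I
    using cyc by (metis image_mono subset_imageE)
  have "I \<in> indeps (cycle_matroid H) \<longleftrightarrow> I \<in> (\<lambda>I. f ` I) ` indeps (cycle_matroid G)" for I
  proof
    assume I: "I \<in> indeps (cycle_matroid H)"
    then obtain I' where "I' \<subseteq> edges G" "I = f ` I'"
      unfolding cycle_matroid_def using E by (auto elim: subset_imageE)
    then show "I \<in> (\<lambda>I. f ` I) ` indeps (cycle_matroid G)"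
      using I acyc[of I'] unfolding cycle_matroid_def by auto
  next
    assume "I \<in> (\<lambda>I. f ` I) ` indeps (cycle_matroid G)"
    then obtain I' where "I = f ` I'" "I' \<in> indeps (cycle_matroid G)" by auto
    then show "I \<in> indeps (cycle_matroid H)"
      using acyc[of I'] E unfolding cycle_matroid_def by auto
  qed
  then have "indeps (cycle_matroid H) = (\<lambda>I. f ` I) ` indeps (cycle_matroid G)" by blast
  then show ?thesis using E unfolding map_matroid_def by (simp add: cycle_matroid_def)
qed

text \<open>As \<open>f\<close> is not a loop, the cycle has length at least two, and each end of
  \<open>f\<close> is shared with the preceding or the following edge. In length two both of these
  are the parallel edge.\<close>

lemma cycle_degree_ne_1:
  assumes C: "is_cycle G C" and f: "f \<in> C" "ends G f = {v, w}" "v \<noteq> w"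
  shows "\<exists>g \<in> C. g \<noteq> f \<and> v \<in> ends G g"
proof -
  obtain vs es where c: "es \<noteq> []" "distinct es"
      "\<forall>i < length es. ends G (es ! i) = {vs ! i, vs ! (Suc i mod length es)}" "C = set es"
    using C unfolding is_cycle_def by auto
  let ?n = "length es"
  obtain k where k: "k < ?n" "f = es ! k" using f c(4) by (auto simp: in_set_conv_nth)
  have ek: "{vs ! k, vs ! (Suc k mod ?n)} = {v, w}" using c(3) k f by auto
  have n: "?n \<ge> 2"
  proof (rule ccontr)
    assume "\<not> ?n \<ge> 2"
    then have "?n = 1" using c(1) k by linarith
    then show False using ek k f(3) by (auto simp: doubleton_eq_iff)
  qed
  have "\<exists>j < ?n. j \<noteq> k \<and> v \<in> ends G (es ! j)"
  proof (cases "v = vs ! k")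
    case True
    \<comment> \<open>The cyclic predecessor of \<open>k\<close>.\<close>
    define j where "j = (if k = 0 then ?n - 1 else k - 1)"
    have "j < ?n" "j \<noteq> k" "Suc j mod ?n = k" using n k unfolding j_def by auto
    then show ?thesis using c(3) True by auto
  next
    case False
    then have v: "v = vs ! (Suc k mod ?n)" using ek by (auto simp: doubleton_eq_iff)
    have "Suc k mod ?n < ?n" using c(1) by simp
    moreover have "Suc k mod ?n \<noteq> k" using n k by (cases "Suc k = ?n") auto
    ultimately show ?thesis using c(3) v by auto
  qed
  then obtain j where "j < ?n" "j \<noteq> k" "v \<in> ends G (es ! j)" by blast
  then show ?thesis using c(2,4) k by (auto simp: nth_eq_iff_index_eq intro!: bexI[of _ "es ! j"])
qed

section \<open>Paths and how they close to cycles\<close>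

definition path :: "('v, 'e) pre_multigraph \<Rightarrow> 'v list \<Rightarrow> 'e list \<Rightarrow> bool" where
  "path G vs es \<longleftrightarrow> length vs = Suc (length es) \<and> distinct vs \<and>
    (\<forall>i < length es. ends G (es ! i) = {vs ! i, vs ! Suc i})"

lemma path_Cons:
  assumes "path G vs es" "w \<notin> set vs" "ends G g = {vs ! 0, w}"
  shows "path G (w # vs) (g # es)"
proof -
  have "ends G ((g # es) ! i) = {(w # vs) ! i, (w # vs) ! Suc i}" if "i < Suc (length es)" for i
    using assms that unfolding path_def by (cases i) auto
  then show ?thesis using assms unfolding path_def by simp
qed

text \<open>The cycle runs along the path from \<open>vs ! 0\<close> to \<open>vs ! j\<close> and
  returns by \<open>g\<close>. For \<open>j = 0\<close> it is a loop, for \<open>j = 1\<close> a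
  pair of parallel edges, where \<open>g\<close> must differ from \<open>es ! 0\<close>.\<close>

lemma path_closes:
  assumes p: "path G vs es" and j: "j < length vs"
    and g: "ends G g = {vs ! 0, vs ! j}" "es \<noteq> [] \<Longrightarrow> g \<noteq> es ! 0"
    and sub: "set vs \<subseteq> verts G" "insert g (set es) \<subseteq> edges G"
  shows "is_cycle G (insert g (set (take j es)))"
proof -
  have pl: "length vs = Suc (length es)" and pd: "distinct vs"
    and pe: "\<And>i. i < length es \<Longrightarrow> ends G (es ! i) = {vs ! i, vs ! Suc i}"
    using p unfolding path_def by auto
  have jl: "j \<le> length es" using j pl by simp
  \<comment> \<open>Distinct vertices force distinct edges, since different positions have different
    pairs of ends.\<close>
  have "distinct es"
    unfolding distinct_conv_nth
  proof (intro allI impI notI)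
    fix i k assume ik: "i < length es" "k < length es" "i \<noteq> k" "es ! i = es ! k"
    then have "{vs ! i, vs ! Suc i} = {vs ! k, vs ! Suc k}" using pe by metis
    then show False using ik pd pl by (auto simp: doubleton_eq_iff nth_eq_iff_index_eq)
  qed
  \<comment> \<open>Only the first edge of the path meets \<open>vs ! 0\<close>, and
    \<open>g\<close> is not that edge.\<close>
  moreover have "g \<notin> set es"
  proof
    assume "g \<in> set es"
    then obtain i where i: "i < length es" "es ! i = g" by (auto simp: in_set_conv_nth)
    then have "vs ! 0 \<in> {vs ! i, vs ! Suc i}" using pe g by (metis insertI1)
    then have "i = 0" using pd pl i by (auto simp: nth_eq_iff_index_eq)
    then show False using g(2) i by auto
  qed
  moreover have "set (take j es) \<subseteq> set es" by (rule set_take_subset)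
  ultimately have d: "distinct (take j es @ [g])" by auto
  \<comment> \<open>The closing edge has index \<open>j\<close>, where the successor wraps around to
    0.\<close>
  have "ends G ((take j es @ [g]) ! i) = {take (Suc j) vs ! i, take (Suc j) vs ! (Suc i mod Suc j)}"
    if "i < Suc j" for i
  proof (cases "i = j")
    case True
    then show ?thesis using jl g(1) by (auto simp: nth_append)
  next
    case False
    then show ?thesis using that jl pe[of i] by (auto simp: nth_append)
  qed
  moreover have "set (take (Suc j) vs) \<subseteq> verts G" using sub(1) set_take_subset by fastforce
  moreover have "set (take j es) \<subseteq> edges G" using sub(2) set_take_subset by fastforce
  moreover have "length (take j es @ [g]) = Suc j" "length (take (Suc j) vs) = Suc j"
    using jl pl by auto
  ultimately show ?thesis
    unfolding is_cycle_def using d pd sub(2)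
    by (intro exI[of _ "take (Suc j) vs"] exI[of _ "take j es @ [g]"]) (auto simp del: length_append)
qed

section \<open>Leaves and sizes of forests\<close>

context multigraph
begin

lemma edge_ends:
  assumes "e \<in> edges G" "v \<in> ends G e"
  shows "\<exists>w \<in> verts G. ends G e = {v, w}"
proof -
  have "\<exists>w. ends G e = {v, w}"
    using card_ends[OF assms(1)] assms(2) by (auto simp: card_1_singleton_iff card_2_iff)
  then show ?thesis using ends_subset[OF assms(1)] by auto
qed

lemma ends_nonempty: "e \<in> edges G \<Longrightarrow> ends G e \<noteq> {}"
  using card_ends by fastforce

text \<open>Without a leaf, every path in \<open>J\<close> could be extended at its front: the new
  edge cannot return to the path, as this would close a cycle. Paths would then become longer than
  the finite vertex set allows.\<close>

lemma forest_has_leaf: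
  assumes J: "J \<in> indeps (cycle_matroid G)" "J \<noteq> {}"
  shows "\<exists>v w f. f \<in> J \<and> ends G f = {v, w} \<and> v \<noteq> w \<and> (\<forall>g \<in> J. v \<in> ends G g \<longrightarrow> g = f)"
proof (rule ccontr)
  assume no_leaf: "\<not> ?thesis"
  have JE: "J \<subseteq> edges G" and acyc: "\<And>C. C \<subseteq> J \<Longrightarrow> \<not> is_cycle G C"
    using J unfolding cycle_matroid_def by auto
  let ?P = "\<lambda>vs es. path G vs es \<and> set vs \<subseteq> verts G \<and> set es \<subseteq> J \<and> es \<noteq> []"
  have close: False
    if P: "path G vs es" "set vs \<subseteq> verts G" "set es \<subseteq> J"
      and g: "g \<in> J" "ends G g = {vs ! 0, w}" "w \<in> set vs" "es \<noteq> [] \<Longrightarrow> g \<noteq> es ! 0"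
    for vs es g w
  proof -
    obtain j where "j < length vs" "w = vs ! j" using g(3) by (auto simp: in_set_conv_nth)
    then have "is_cycle G (insert g (set (take j es)))"
      using path_closes[of G vs es j g] P g JE by auto
    moreover have "insert g (set (take j es)) \<subseteq> J"
      using g P set_take_subset[of j es] by auto
    ultimately show False using acyc by blast
  qed
  \<comment> \<open>A loop would close the path with one vertex and no edge.\<close>
  have noloop: "v \<noteq> w" if "f \<in> J" "ends G f = {v, w}" for f v w
    using close[of "[v]" "[]" f w] ends_subset[of f] that JE by (auto simp: path_def)
  \<comment> \<open>Starting from one edge ensures that \<open>es ! 0\<close> exists, the edge that
    the next one must avoid.\<close>
  have ex: "\<exists>vs es. ?P vs es \<and> length es = Suc n" for n
  proof (induction n)
    case 0
    obtain f where f: "f \<in> J" using J by auto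
    then obtain v where v: "v \<in> ends G f" using ends_nonempty JE by blast
    then obtain w where w: "ends G f = {v, w}" using edge_ends f JE by blast
    then have "?P [v, w] [f]"
      using noloop[OF f w] f ends_subset[of f] JE by (auto simp: path_def)
    then show ?case by (metis length_Cons list.size(3))
  next
    case (Suc n)
    then obtain vs es where P: "?P vs es" "length es = Suc n" by blast
    then have f: "es ! 0 \<in> J" "ends G (es ! 0) = {vs ! 0, vs ! Suc 0}"
      by (auto simp: path_def subset_iff)
    then obtain g where g: "g \<in> J" "g \<noteq> es ! 0" "vs ! 0 \<in> ends G g"
      using no_leaf noloop[OF f] by blast
    obtain w where w: "w \<in> verts G" "ends G g = {vs ! 0, w}"
      using edge_ends g JE by blast
    have "w \<notin> set vs" using close[of vs es g w] P g w by auto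
    then have "?P (w # vs) (g # es)"
      using path_Cons[of G vs es w g] P g w by auto
    then show ?case using P(2) by (metis length_Cons)
  qed
  obtain vs es where P: "?P vs es" "length es = Suc (card (verts G))" using ex by blast
  then have "card (set vs) > card (verts G)" by (auto simp: path_def distinct_card)
  then show False using P card_mono[OF finite_verts, of "set vs"] by auto
qed

text \<open>Induction by deleting a leaf together with its only edge. An arbitrary \<open>V\<close>
  covering the ends lets the vertices of a component be used, including those that \<open>J\<close>
  does not meet.\<close>

lemma card_forest_less:
  assumes "J \<in> indeps (cycle_matroid G)" "(\<Union>f \<in> J. ends G f) \<subseteq> V" "finite V" "V \<noteq> {}"
  shows "card J < card V"
  using assms
proof (induction "card V" arbitrary: V J)
  case 0
  then show ?case by simp
next
  case (Suc n)
  show ?case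
  proof (cases "J = {}")
    case True
    then show ?thesis using Suc.prems by (simp add: card_gt_0_iff)
  next
    case False
    then obtain v w f where f: "f \<in> J" "ends G f = {v, w}" "v \<noteq> w"
        "\<forall>g \<in> J. v \<in> ends G g \<longrightarrow> g = f"
      using forest_has_leaf Suc.prems(1) by blast
    have vw: "v \<in> V" "w \<in> V" using f Suc.prems(2) by auto
    have "J - {f} \<in> indeps (cycle_matroid G)"
      using indep_cycle_matroid_subset[OF Suc.prems(1)] by blast
    moreover have "(\<Union>g \<in> J - {f}. ends G g) \<subseteq> V - {v}" using f Suc.prems(2) by blast
    \<comment> \<open>The other end \<open>w\<close> of the leaf edge remains.\<close>
    moreover have "V - {v} \<noteq> {}" using vw f by blast
    moreover have cV: "card V = Suc (card (V - {v}))" using vw Suc.prems by (simp only: card.remove)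
    ultimately have "card (J - {f}) < card (V - {v})"
      using Suc.hyps(1)[of "V - {v}" "J - {f}"] Suc.prems(3) Suc.hyps(2) by simp
    moreover have "finite J"
      using Suc.prems(1) finite_edges finite_subset unfolding cycle_matroid_def by fastforce
    then have "card J = Suc (card (J - {f}))" using f by (simp only: card.remove)
    ultimately show ?thesis using cV by simp
  qed
qed

end


section \<open>Connectedness\<close>

lemma reachable_sym:
  assumes "(adjacent G)\<^sup>*\<^sup>* u v"
  shows "(adjacent G)\<^sup>*\<^sup>* v u"
proof -
  have "symp (adjacent G)" by (auto simp: symp_def adjacent_def insert_commute)
  then show ?thesis using assms by (meson symp_rtranclp sympD)
qed

lemma component_of_eq:
  assumes "(adjacent G)\<^sup>*\<^sup>* u v"
  shows "component_of G u = component_of G v"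
proof -
  have "(adjacent G)\<^sup>*\<^sup>* u x \<longleftrightarrow> (adjacent G)\<^sup>*\<^sup>* v x" for x
    using assms reachable_sym by (metis rtranclp_trans)
  then show ?thesis unfolding component_of_def by simp
qed

text \<open>Walking from \<open>vs ! 0\<close> along the cycle reaches all its vertices, so it stays
  in one component of the subgraph on \<open>X\<close>. Hence cycles in different components share
  no edge.\<close>

lemma cycle_connected:
  assumes C: "is_cycle G C" "C \<subseteq> X" and f: "f \<in> C" "x \<in> ends G f" and g: "g \<in> C" "y \<in> ends G g"
  shows "(adjacent (edge_subgraph G X))\<^sup>*\<^sup>* x y"
proof -
  obtain vs es where c: "es \<noteq> []"
      "\<forall>i < length es. ends G (es ! i) = {vs ! i, vs ! (Suc i mod length es)}" "C = set es"
    using C unfolding is_cycle_def by auto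
  let ?R = "adjacent (edge_subgraph G X)"
  let ?n = "length es"
  have adj: "?R (vs ! i) (vs ! (Suc i mod ?n))" if "i < ?n" for i
    using c C that unfolding adjacent_def edge_subgraph_def by (auto intro!: bexI[of _ "es ! i"])
  have reach: "?R\<^sup>*\<^sup>* (vs ! 0) (vs ! i)" if "i < ?n" for i
    using that
  proof (induction i)
    case (Suc i)
    then show ?case using adj[of i] by (auto intro: rtranclp.rtrancl_into_rtrancl)
  qed simp
  have "?R\<^sup>*\<^sup>* (vs ! 0) z" if h: "h \<in> C" "z \<in> ends G h" for h z
  proof -
    obtain i where i: "i < ?n" "h = es ! i" using h c(3) by (auto simp: in_set_conv_nth)
    then have "z = vs ! i \<or> z = vs ! (Suc i mod ?n)" using c(2) h by auto
    moreover have "Suc i mod ?n < ?n" using c(1) by simp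
    ultimately show ?thesis using reach i by auto
  qed
  then show ?thesis using f g reachable_sym by (metis rtranclp_trans)
qed


section \<open>The framework\<close>

text \<open>The three assumptions on independent sets collect what the contraction provides, so that
  the graph argument involves neither \<open>M'\<close> nor the type \<open>'a option\<close>.
  \<open>rank_drop\<close> yields the rank bound, \<open>spans\<close> the closure condition, and
  \<open>spans\<close> with \<open>disjoint\<close> the bound on components.\<close>

lemma framework_of_lift:
  assumes "matroid M" and "multigraph G" and E: "edges G = ground M"
    and rank_drop: "\<And>I. I \<in> indeps M \<Longrightarrow>
      \<exists>J \<subseteq> I. J \<in> indeps (cycle_matroid G) \<and> card I \<le> Suc (card J)"
    and spans: "\<And>I X f. \<lbrakk>I \<in> indeps M; I \<subseteq> X; insert f I \<notin> indeps M; f \<notin> X;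
        insert f X \<subseteq> ground M\<rbrakk> \<Longrightarrow>
      \<exists>J \<subseteq> X. J \<in> indeps (cycle_matroid G) \<and> insert f J \<notin> indeps (cycle_matroid G)"
    and disjoint: "\<And>D1 D2. \<lbrakk>D1 \<union> D2 \<in> indeps M; D1 \<inter> D2 = {}; D1 \<notin> indeps (cycle_matroid G)\<rbrakk> \<Longrightarrow>
      D2 \<in> indeps (cycle_matroid G)"
  shows "framework G M"
proof -
  interpret matroid M by fact
  interpret multigraph G by fact
  have "rank M (edges H) \<le> card (verts H)" if H: "H \<in> components G" for H
    unfolding rank_le_iff
  proof (intro ballI impI)
    obtain v where v: "v \<in> verts G" "H = component_of G v"
      using H unfolding components_def by auto
    fix I assume I: "I \<in> indeps M" "I \<subseteq> edges H"
    then obtain J where J: "J \<subseteq> I" "J \<in> indeps (cycle_matroid G)" "card I \<le> Suc (card J)"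
      using rank_drop by blast
    have "(\<Union>f \<in> J. ends G f) \<subseteq> verts H" "finite (verts H)" "verts H \<noteq> {}"
      using v I J finite_verts unfolding component_of_def induced_subgraph_def by auto
    \<comment> \<open>The strict inequality for forests makes up for the one element lost in
      \<open>rank_drop\<close>.\<close>
    then have "card J < card (verts H)" by (rule card_forest_less[OF J(2)])
    then show "card I \<le> card (verts H)" using J(3) by simp
  qed
  moreover have "cl M (edges (delete_vertex G v)) \<subseteq> edges (delete_vertex G v) \<union> loops G v"
    if v: "v \<in> verts G" for v
  proof (rule ccontr)
    let ?X = "edges (delete_vertex G v)"
    assume "\<not> ?thesis"
    then obtain f where f: "f \<in> cl M ?X" "f \<notin> ?X" "f \<notin> loops G v" by blast
    have fE: "f \<in> edges G" using f(1) E unfolding cl_def by auto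
    have X: "?X = {g \<in> edges G. v \<notin> ends G g}"
      using ends_subset unfolding delete_vertex_def induced_subgraph_def by auto
    then have "v \<in> ends G f" using f fE by auto
    then obtain w where w: "ends G f = {v, w}" using edge_ends[OF fE] by blast
    have "v \<noteq> w" using w f(3) fE unfolding loops_def by auto
    obtain I where I: "I \<in> indeps M" "I \<subseteq> ?X" "insert f I \<notin> indeps M"
      using in_cl_dependent[OF f(1,2)] by blast
    have "insert f ?X \<subseteq> ground M" using fE X E by auto
    then obtain J where J: "J \<subseteq> ?X" "J \<in> indeps (cycle_matroid G)" "insert f J \<notin> indeps (cycle_matroid G)"
      using spans[OF I f(2)] by blast
    then obtain C where C: "is_cycle G C" "C \<subseteq> insert f J" "f \<in> C"
      using cycle_through_edge[OF J(2,3) fE] by blast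
    \<comment> \<open>All edges of \<open>C\<close> other than \<open>f\<close> lie in
      \<open>?X\<close> and so avoid \<open>v\<close>, whereas a cycle needs a second edge
      there.\<close>
    obtain g where "g \<in> C" "g \<noteq> f" "v \<in> ends G g"
      using cycle_degree_ne_1[OF C(1,3) w \<open>v \<noteq> w\<close>] by blast
    then show False using C(2) J(1) X by blast
  qed
  moreover have "card (components (edge_subgraph G C)) \<le> 2" if C: "circuit M C" for C
  proof (rule ccontr)
    let ?H = "edge_subgraph G C"
    assume "\<not> ?thesis"
    then obtain S where "S \<subseteq> components ?H" "card S = 3"
      using obtain_subset_with_card_n[of 3 "components ?H"] by auto
    then obtain H1 H2 H3 where H: "{H1, H2, H3} \<subseteq> components ?H"
        "H1 \<noteq> H2" "H1 \<noteq> H3" "H2 \<noteq> H3"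
      by (auto simp: card_3_iff)
    have CE: "C \<subseteq> edges G" using C E unfolding circuit_def by simp
    have cyc: "\<exists>D f x. is_cycle G D \<and> D \<subseteq> C \<and> f \<in> D \<and> x \<in> ends G f \<and> K = component_of ?H x"
      if K: "K \<in> components ?H" for K
    proof -
      obtain f x where f: "f \<in> C" "x \<in> ends G f" "K = component_of ?H x"
        using K unfolding components_def edge_subgraph_def by auto
      \<comment> \<open>A circuit without \<open>f\<close> is independent and spans
        \<open>f\<close>, which gives a cycle through \<open>f\<close> inside
        \<open>C\<close>.\<close>
      have "C - {f} \<in> indeps M" "insert f (C - {f}) \<notin> indeps M"
        using C f unfolding circuit_def by (auto simp: insert_absorb)
      then obtain J where J: "J \<subseteq> C - {f}" "J \<in> indeps (cycle_matroid G)"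
          "insert f J \<notin> indeps (cycle_matroid G)"
        using spans[of "C - {f}" "C - {f}" f] f(1) CE E by auto
      then obtain D where "is_cycle G D" "D \<subseteq> insert f J" "f \<in> D"
        using cycle_through_edge[OF J(2,3)] f(1) CE by blast
      then show ?thesis using f J(1) by blast
    qed
    \<comment> \<open>A common edge would place both cycles in the same component.\<close>
    have disj: "D \<inter> D' = {}"
      if D: "is_cycle G D" "D \<subseteq> C" "f \<in> D" "x \<in> ends G f"
        and D': "is_cycle G D'" "D' \<subseteq> C" "f' \<in> D'" "x' \<in> ends G f'"
        and ne: "component_of ?H x \<noteq> component_of ?H x'" for D D' f f' x x'
    proof (rule ccontr)
      assume "D \<inter> D' \<noteq> {}"
      then obtain g where g: "g \<in> D" "g \<in> D'" by blast
      then obtain y where y: "y \<in> ends G g" using ends_nonempty D(2) CE by blast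
      then have "component_of ?H x = component_of ?H y" "component_of ?H x' = component_of ?H y"
        using cycle_connected[OF D(1,2,3,4) g(1) y] cycle_connected[OF D'(1,2,3,4) g(2) y]
        by (simp_all add: component_of_eq)
      then show False using ne by simp
    qed
    obtain D1 f1 x1 where D1: "is_cycle G D1" "D1 \<subseteq> C" "f1 \<in> D1" "x1 \<in> ends G f1"
      "H1 = component_of ?H x1" using cyc[of H1] H by auto
    obtain D2 f2 x2 where D2: "is_cycle G D2" "D2 \<subseteq> C" "f2 \<in> D2" "x2 \<in> ends G f2"
      "H2 = component_of ?H x2" using cyc[of H2] H by auto
    obtain D3 f3 x3 where D3: "is_cycle G D3" "D3 \<subseteq> C" "f3 \<in> D3" "x3 \<in> ends G f3"
      "H3 = component_of ?H x3" using cyc[of H3] H by auto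
    have "D1 \<inter> D3 = {}" "D2 \<inter> D3 = {}" "D1 \<inter> D2 = {}"
      using disj[OF D1(1-4) D3(1-4)] disj[OF D2(1-4) D3(1-4)] disj[OF D1(1-4) D2(1-4)]
        D1(5) D2(5) D3(5) H by auto
    \<comment> \<open>The inclusion is proper because \<open>D3\<close> is nonempty and disjoint
      from both; minimality of the circuit then applies.\<close>
    then have "D1 \<union> D2 \<subset> C" using D1 D2 D3 by blast
    then have "D1 \<union> D2 \<in> indeps M" using C unfolding circuit_def by blast
    then have "D2 \<in> indeps (cycle_matroid G)"
      using disjoint[OF _ \<open>D1 \<inter> D2 = {}\<close> cycle_dependent[OF D1(1)]] by simp
    then show False using cycle_dependent[OF D2(1)] by simp
  qed
  ultimately show ?thesis
    unfolding framework_def using E multigraph_axioms by blast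
qed

theorem theorem1p2:
  fixes M :: "'a pre_matroid"
  assumes "matroid M" and "lifted_graphic M"
  shows "quasi_graphic M"
proof -
  obtain M' :: "'a option pre_matroid" and e and G' :: "(nat, 'a option) pre_multigraph"
    where M': "matroid M'" "delete M' {e} = map_matroid Some M"
      and G': "multigraph G'" "contract M' {e} = cycle_matroid G'"
    using assms(2) unfolding lifted_graphic_def graphic_def by blast
  interpret M': matroid M' by fact
  interpret G': multigraph G' by fact
  \<comment> \<open>\<open>G'\<close> with each edge \<open>Some x\<close> renamed to
    \<open>x\<close>.\<close>
  define G where "G = \<lparr>verts = verts G', edges = ground M, ends = ends G' \<circ> Some\<rparr>"
  \<comment> \<open>The element \<open>e\<close> need not be \<open>None\<close>: it may be
    \<open>Some y\<close> with \<open>y\<close> outside \<open>ground M\<close>. This is why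
    \<open>indM\<close> keeps a condition on \<open>e\<close>.\<close>
  have gr: "ground M' - {e} = Some ` ground M"
    using arg_cong[OF M'(2), of ground] unfolding delete_def map_matroid_def by simp
  have E': "edges G' = Some ` ground M"
    using arg_cong[OF G'(2), of ground] gr unfolding contract_def cycle_matroid_def by simp
  have "multigraph G"
  proof
    show "finite (edges G)"
      using \<open>matroid M\<close> unfolding G_def by (simp add: matroid.finite_ground)
  qed (use E' G'.finite_verts G'.ends_subset G'.card_ends in \<open>auto simp: G_def\<close>)
  have "cycle_matroid G' = map_matroid Some (cycle_matroid G)"
    by (rule cycle_matroid_relabel) (auto simp: G_def E')
  then have indG: "Some ` I \<in> indeps (contract M' {e}) \<longleftrightarrow> I \<in> indeps (cycle_matroid G)" for I
    unfolding G'(2) map_matroid_def by (auto simp: inj_image_eq_iff)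
  have indD: "{I \<in> indeps M'. I \<subseteq> ground M' - {e}} = (\<lambda>I. Some ` I) ` indeps M"
    using arg_cong[OF M'(2), of indeps] unfolding delete_def map_matroid_def by simp
  have indM: "I \<in> indeps M \<longleftrightarrow> Some ` I \<in> indeps M' \<and> e \<notin> Some ` I" for I
  proof -
    have "I \<in> indeps M \<longleftrightarrow> Some ` I \<in> {I \<in> indeps M'. I \<subseteq> ground M' - {e}}"
      using indD by (auto simp: inj_image_eq_iff)
    then show ?thesis using M'.indep_subset_ground by blast
  qed
  have "framework G M"
  proof (rule framework_of_lift)
    fix I assume "I \<in> indeps M"
    then obtain J' where J': "J' \<subseteq> Some ` I" "J' \<in> indeps (contract M' {e})"
        "card (Some ` I) \<le> Suc (card J')"
      using M'.contract_rank_drop[of "Some ` I" e] indM[of I] by auto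
    \<comment> \<open>A subset of an image under \<open>Some\<close> is again such an image, which
      brings the witness back to the edges of \<open>G\<close>.\<close>
    then obtain J where "J \<subseteq> I" "J' = Some ` J" by (auto elim: subset_imageE)
    then show "\<exists>J \<subseteq> I. J \<in> indeps (cycle_matroid G) \<and> card I \<le> Suc (card J)"
      using J' indG by (auto simp: card_image)
  next
    fix I X f
    assume *: "I \<in> indeps M" "I \<subseteq> X" "insert f I \<notin> indeps M" "f \<notin> X"
      "insert f X \<subseteq> ground M"
    \<comment> \<open>Independence in \<open>M\<close> always transfers to \<open>M'\<close>, but
      dependence only for sets whose image avoids \<open>e\<close>.\<close>
    have e: "e \<notin> Some ` insert f X" using *(5) gr by blast
    then have "insert (Some f) (Some ` I) \<notin> indeps M'"
      using *(2,3) indM[of "insert f I"] by auto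
    then obtain J' where J': "J' \<subseteq> Some ` X" "J' \<in> indeps (contract M' {e})"
        "insert (Some f) J' \<notin> indeps (contract M' {e})"
      using M'.contract_spans[of "Some ` I" "Some ` X" "Some f" e] * e indM[of I] by auto
    then obtain J where "J \<subseteq> X" "J' = Some ` J" by (auto elim: subset_imageE)
    then show "\<exists>J \<subseteq> X. J \<in> indeps (cycle_matroid G) \<and> insert f J \<notin> indeps (cycle_matroid G)"
      using J' indG[of J] indG[of "insert f J"] by auto
  next
    fix D1 D2
    assume *: "D1 \<union> D2 \<in> indeps M" "D1 \<inter> D2 = {}" "D1 \<notin> indeps (cycle_matroid G)"
    then have "Some ` D1 \<union> Some ` D2 \<in> indeps M'" "e \<notin> Some ` D1 \<union> Some ` D2"
      using indM[of "D1 \<union> D2"] by (auto simp: image_Un)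
    moreover have "Some ` D1 \<inter> Some ` D2 = {}" using *(2) by auto
    ultimately show "D2 \<in> indeps (cycle_matroid G)"
      using M'.contract_disjoint_dependent[of "Some ` D1" "Some ` D2" e] *(3) indG by blast
  qed (use assms \<open>multigraph G\<close> in \<open>auto simp: G_def\<close>)
  then show ?thesis unfolding quasi_graphic_def by blast
qed

end
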